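(* Let $\mathbb{G}$ be an infinite, connected, locally finite graph with basepoint $o\in V(\mathbb{G})$ such that $\imath_V^*(\mathbb{G})>0$. Consider $p$-Bernoulli site percolation on $\mathbb{G}$ with $p\in[0,1]$ and let $\mathbb{H}$ be the open cluster containing $o$. If $p>1/(\imath_V^*(\mathbb{G})+1)$, then almost surely on the event that $\mathbb{H}$ is infinite, $\imath_V^*(\mathbb{H})>0$.
   Context: For a graph $G$ and $S\subset V(G)$, $|S|$ is the cardinality of $S$, and $\partial^V S$ is the set of vertices of $G$ in $S^c$ that have a neighbor (in $G$) in $S$. $S$ is called connected if the subgraph of $G$ induced on $S$ is connected. For an infinite connected graph $G$ with basepoint $o$, $$\imath_V^*(G):=\lim_{n\to\infty}\inf\left\{\frac{|\partial^V S|}{|S|}: o\in S\subset V(G),\ S\text{ is connected},\ n\le |S|<\infty\right\}.$$ In $p$-Bernoulli site percolation on $\mathbb{G}$, each vertex of $\mathbb{G}$ is independently declared open with probability $p$ and closed with probability $1-p$; open clusters are the connected components of the subgraph of $\mathbb{G}$ induced on the open vertices (the cluster of $o$ is empty if $o$ is closed). The constant $\imath_V^*(\mathbb{H})$ is computed in the random graph $\mathbb{H}$, with basepoint $o$. *)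

theory Defs
  imports
    "HOL-Probability.Probability"
    "Graph_Theory.Digraph_Component"
begin

text \<open>
  Undirected graphs, not necessarily finite, are symmetric digraphs (\<^locale>\<open>sym_digraph\<close>):
  an edge between \<open>u\<close> and \<open>v\<close> is represented by arcs in both directions. Loops and parallel
  edges are allowed. The names \<open>connected\<close> below are qualified because of the topological
  constant of the same name.
\<close>

definition locally_finite :: "('a, 'b) pre_digraph \<Rightarrow> bool" where
  "locally_finite G \<longleftrightarrow> (\<forall>v \<in> verts G. finite (out_arcs G v))"

definition vertex_boundary :: "('a, 'b) pre_digraph \<Rightarrow> 'a set \<Rightarrow> 'a set" where
  "vertex_boundary G S = {v \<in> verts G - S. \<exists>u \<in> S. u \<rightarrow>\<^bsub>G\<^esub> v}"

text \<open>
  The value lies in \<open>[0, \<infinity>]\<close>; it can be infinite when the degrees are unbounded. In a locally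
  finite graph the boundary of a finite set is finite, so \<^const>\<open>card\<close> has its usual meaning
  here; the definition is not meant for other graphs.
\<close>

definition anchored_vertex_ratio_inf :: "('a, 'b) pre_digraph \<Rightarrow> 'a \<Rightarrow> nat \<Rightarrow> ereal" where
  "anchored_vertex_ratio_inf G r n =
    Inf {ereal (real (card (vertex_boundary G S)) / real (card S)) | S.
           r \<in> S \<and> S \<subseteq> verts G \<and> Digraph_Component.connected (G \<restriction> S) \<and>
           finite S \<and> n \<le> card S}"

definition anchored_vertex_expansion :: "('a, 'b) pre_digraph \<Rightarrow> 'a \<Rightarrow> ereal" where
  "anchored_vertex_expansion G r = lim (anchored_vertex_ratio_inf G r)"

lemma anchored_vertex_ratio_inf_LIMSEQ:
  "anchored_vertex_ratio_inf G r \<longlonglongrightarrow> anchored_vertex_expansion G r"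
proof -
  have "incseq (anchored_vertex_ratio_inf G r)"
    unfolding incseq_def anchored_vertex_ratio_inf_def
    by (intro allI impI Inf_superset_mono) auto
  then have "convergent (anchored_vertex_ratio_inf G r)"
    unfolding convergent_def using LIMSEQ_SUP by blast
  then show ?thesis
    unfolding anchored_vertex_expansion_def by (simp add: convergent_LIMSEQ_iff)
qed

text \<open>
  A configuration is a function \<open>\<omega>\<close>, where \<open>\<omega> v\<close> means that the vertex \<open>v\<close> is open.
\<close>

definition site_percolation :: "('a, 'b) pre_digraph \<Rightarrow> real \<Rightarrow> ('a \<Rightarrow> bool) measure" where
  "site_percolation G p = Pi\<^sub>M (verts G) (\<lambda>_. measure_pmf (bernoulli_pmf p))"

definition open_subgraph :: "('a, 'b) pre_digraph \<Rightarrow> ('a \<Rightarrow> bool) \<Rightarrow> ('a, 'b) pre_digraph" where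
  "open_subgraph G \<omega> = G \<restriction> {v \<in> verts G. \<omega> v}"

text \<open>
  Reachability in a digraph requires both endpoints to be vertices of it, so the cluster of a
  closed vertex is empty.
\<close>

definition open_cluster ::
    "('a, 'b) pre_digraph \<Rightarrow> ('a \<Rightarrow> bool) \<Rightarrow> 'a \<Rightarrow> ('a, 'b) pre_digraph" where
  "open_cluster G \<omega> r = open_subgraph G \<omega> \<restriction> {v. r \<rightarrow>\<^sup>*\<^bsub>open_subgraph G \<omega>\<^esub> v}"

end

theory Submission
  imports Defs
begin

text \<open>
  Fix a real \<open>h > 0\<close> below the anchored expansion of \<open>G\<close> such that \<open>q = 1 / (1 + h) < p\<close>. All but
  small anchored sets \<open>S\<close> (finite, connected, containing the root \<open>r\<close>) have at least \<open>h |S|\<close>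
  boundary vertices. Such a set violates expansion with constant \<open>\<epsilon>\<close> in the open cluster of \<open>r\<close>
  only if it is thin: all of \<open>S\<close> is open and at most \<open>\<epsilon> |S|\<close> of its boundary vertices are open.
  By Borel-Cantelli it suffices to show that the probabilities of these events, taken over all
  these \<open>S\<close> at once, have a finite sum.

  No enumeration of the sets \<open>S\<close> is needed, because percolation at the smaller parameter \<open>q\<close> does
  the counting. The events that \<open>S\<close> is open and its whole boundary is closed are pairwise disjoint
  as \<open>S\<close> varies (\<open>disjoint_cylinders\<close>), since each of them forces the cluster of \<open>r\<close> to be \<open>S\<close>.
  Hence their \<open>q\<close>-probabilities \<open>q ^ n * (1 - q) ^ m\<close>, where \<open>n = |S|\<close> and \<open>m\<close> is the size of the
  boundary, add up to at most 1. By an exponential Markov bound (\<open>measure_thin_event_le\<close>) the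
  \<open>p\<close>-probability that \<open>S\<close> is thin is at most
  \<open>p ^ n * t powr (- \<epsilon> * n) * (p * t + (1 - p)) ^ m\<close> for every \<open>t\<close> in \<open>(0, 1)\<close>. The function
  \<open>x \<mapsto> ln x + h * ln (1 - x)\<close> attains its maximum at \<open>q\<close> and is strictly decreasing beyond it, so for
  \<open>m \<ge> h * n\<close> and suitable small \<open>t\<close> and \<open>\<epsilon>\<close> the second quantity is at most the first
  (\<open>exponential_comparison\<close>).
\<close>

section \<open>A comparison form of the Borel-Cantelli lemma\<close>

text \<open>
  Summability of the probabilities is obtained from disjoint events in a second probability
  space. The index set is countable, possibly finite.
\<close>

lemma AE_finite_occurrences:
  assumes "prob_space M" "prob_space N" "countable F"
    and A: "\<And>S. S \<in> F \<Longrightarrow> A S \<in> sets M"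
    and C: "\<And>S. S \<in> F \<Longrightarrow> C S \<in> sets N"
    and disj: "disjoint_family_on C F"
    and le: "\<And>S. S \<in> F \<Longrightarrow> measure M (A S) \<le> measure N (C S)"
  shows "AE x in M. finite {S \<in> F. x \<in> A S}"
proof -
  interpret M: prob_space M by fact
  interpret N: prob_space N by fact
  let ?e = "to_nat_on F" and ?d = "from_nat_into F"
  have inj: "inj_on ?e F" using assms(3) by (rule inj_on_to_nat_on)
  have d: "?d (?e S) = S" if "S \<in> F" for S
    using assms(3) that by simp
  define A' where "A' i = (if i \<in> ?e ` F then A (?d i) else {})" for i
  define C' where "C' i = (if i \<in> ?e ` F then C (?d i) else {})" for i
  have A'sets: "A' i \<in> sets M" and C'sets: "C' i \<in> sets N" for i
    using A C d by (auto simp: A'_def C'_def)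
  have "disjoint_family C'"
    unfolding disjoint_family_on_def
  proof (intro ballI impI)
    fix i j :: nat assume "i \<noteq> j"
    show "C' i \<inter> C' j = {}"
    proof (cases "i \<in> ?e ` F \<and> j \<in> ?e ` F")
      case True
      then obtain S T where "S \<in> F" "T \<in> F" "i = ?e S" "j = ?e T" by blast
      with \<open>i \<noteq> j\<close> show ?thesis
        using disjoint_family_onD[OF disj, of S T] by (auto simp: C'_def d)
    qed (auto simp: C'_def)
  qed
  then have "(\<lambda>i. measure N (C' i)) sums measure N (\<Union>i. C' i)"
    using C'sets by (intro N.finite_measure_UNION) auto
  then have sum_C': "summable (\<lambda>i. measure N (C' i))" by (rule sums_summable)
  have "norm (measure M (A' i)) \<le> measure N (C' i)" for i
    using le d by (auto simp: A'_def C'_def)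
  then have "summable (\<lambda>i. measure M (A' i))"
    by (rule summable_comparison_test'[OF sum_C'])
  then have "AE x in M. eventually (\<lambda>i. x \<in> space M - A' i) sequentially"
    using A'sets by (intro borel_cantelli_AE1) (auto simp: M.emeasure_eq_measure)
  then show ?thesis
  proof eventually_elim
    case (elim x)
    then obtain n where n: "\<And>i. i \<ge> n \<Longrightarrow> x \<notin> A' i"
      by (auto simp: eventually_sequentially)
    have "?e S \<in> {..<n}" if "S \<in> F" "x \<in> A S" for S
      using n[of "?e S"] that d by (force simp: A'_def not_less[symmetric])
    then have "?e ` {S \<in> F. x \<in> A S} \<subseteq> {..<n}" by auto
    then have "finite (?e ` {S \<in> F. x \<in> A S})" by (rule finite_subset) simp
    then show ?case
      by (rule finite_imageD) (rule inj_on_subset[OF inj], auto)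
  qed
qed

section \<open>Locally finite graphs and induced subgraphs\<close>

lemma dominates_iff:
  "u \<rightarrow>\<^bsub>G\<^esub> v \<longleftrightarrow> (\<exists>e\<in>arcs G. tail G e = u \<and> head G e = v)"
  by (auto simp: arcs_ends_conv)

lemma dominates_induce_iff:
  "u \<rightarrow>\<^bsub>G \<restriction> S\<^esub> v \<longleftrightarrow> u \<rightarrow>\<^bsub>G\<^esub> v \<and> u \<in> S \<and> v \<in> S"
  by (auto simp: dominates_iff)

lemma induce_induce_subset:
  "S \<subseteq> T \<Longrightarrow> (G \<restriction> T) \<restriction> S = G \<restriction> S"
  by (auto simp: induce_subgraph_def)

lemma finite_out_neighbours:
  assumes "locally_finite G" "u \<in> verts G"
  shows "finite {v. u \<rightarrow>\<^bsub>G\<^esub> v}"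
proof -
  have "{v. u \<rightarrow>\<^bsub>G\<^esub> v} = head G ` out_arcs G u"
    by (auto simp: dominates_iff out_arcs_def)
  with assms show ?thesis by (simp add: locally_finite_def)
qed

lemma finite_vertex_boundary:
  assumes "locally_finite G" "finite S" "S \<subseteq> verts G"
  shows "finite (vertex_boundary G S)"
proof (rule finite_subset)
  show "vertex_boundary G S \<subseteq> (\<Union>u\<in>S. {v. u \<rightarrow>\<^bsub>G\<^esub> v})"
    by (auto simp: vertex_boundary_def)
  show "finite (\<Union>u\<in>S. {v. u \<rightarrow>\<^bsub>G\<^esub> v})"
    using finite_out_neighbours[OF assms(1)] assms(3) by (intro finite_UN_I[OF assms(2)]) auto
qed

lemma vertex_boundary_subset: "vertex_boundary G S \<subseteq> verts G"
  and vertex_boundary_disjoint: "S \<inter> vertex_boundary G S = {}"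
  by (auto simp: vertex_boundary_def)

lemma connected_induce_reachable:
  assumes "sym_digraph G" "S \<subseteq> verts G" "Digraph_Component.connected (G \<restriction> S)"
    and "u \<in> S" "v \<in> S"
  shows "u \<rightarrow>\<^sup>*\<^bsub>G \<restriction> S\<^esub> v"
proof -
  interpret sym_digraph G by fact
  have "wf_digraph (G \<restriction> S)" by auto
  moreover have "symmetric (G \<restriction> S)"
    using sym_arcs by (auto simp: symmetric_def sym_def dominates_induce_iff)
  ultimately have "strongly_connected (G \<restriction> S)"
    using assms(3) by (rule wf_digraph.symmetric_connected_imp_strongly_connected)
  with assms(4,5) show ?thesis by (simp add: strongly_connected_def)
qed

lemma countable_verts:
  assumes "sym_digraph G" "Digraph_Component.connected G" "locally_finite G" "r \<in> verts G"
  shows "countable (verts G)"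
proof -
  interpret sym_digraph G by fact
  \<comment> \<open>\<open>B k\<close> is the set of endpoints of walks of length \<open>k\<close> from \<open>r\<close>.\<close>
  define B where "B = rec_nat {r} (\<lambda>_ X. \<Union>u\<in>X. {v. u \<rightarrow>\<^bsub>G\<^esub> v})"
  have B_0: "B 0 = {r}" and B_Suc: "B (Suc k) = (\<Union>u\<in>B k. {v. u \<rightarrow>\<^bsub>G\<^esub> v})" for k
    by (simp_all add: B_def)
  have B: "finite (B k) \<and> B k \<subseteq> verts G" for k
  proof (induction k)
    case (Suc k)
    then show ?case
      using finite_out_neighbours[OF assms(3)]
      by (auto simp: B_Suc adj_in_verts)
  qed (simp add: B_0 assms(4))
  have "v \<in> (\<Union>k. B k)" if "v \<in> verts G" for v
  proof -
    have "strongly_connected G"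
      using sym_arcs assms(2) by (rule symmetric_connected_imp_strongly_connected)
    then have "r \<rightarrow>\<^sup>*\<^bsub>G\<^esub> v" using assms(4) that by (simp add: strongly_connected_def)
    then show ?thesis
    proof (induction rule: reachable_induct)
      case base
      show ?case using B_0 by blast
    next
      case (step x y)
      then obtain k where "x \<in> B k" by blast
      with step(2) have "y \<in> B (Suc k)" by (auto simp: B_Suc)
      then show ?case by blast
    qed
  qed
  then have "verts G \<subseteq> (\<Union>k. B k)" by blast
  moreover have "countable (\<Union>k. B k)" using B by (auto intro: countable_finite)
  ultimately show ?thesis by (rule countable_subset)
qed

section \<open>Anchored sets and open clusters\<close>

text \<open>
  The sets over which the infimum in \<^const>\<open>anchored_vertex_ratio_inf\<close> is taken, without the lower
  bound on the cardinality.
\<close>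

definition anchored_sets :: "('a, 'b) pre_digraph \<Rightarrow> 'a \<Rightarrow> 'a set set" where
  "anchored_sets G r = {S. r \<in> S \<and> S \<subseteq> verts G \<and> Digraph_Component.connected (G \<restriction> S) \<and> finite S}"

lemma anchored_vertex_ratio_inf_eq:
  "anchored_vertex_ratio_inf G r n =
    (INF S \<in> {S \<in> anchored_sets G r. n \<le> card S}.
      ereal (real (card (vertex_boundary G S)) / real (card S)))"
  unfolding anchored_vertex_ratio_inf_def anchored_sets_def
  by (rule arg_cong[of _ _ Inf]) auto

lemma anchored_setsD:
  assumes "S \<in> anchored_sets G r"
  shows "r \<in> S" "S \<subseteq> verts G" "finite S" "card S > 0"
  using assms by (auto simp: anchored_sets_def card_gt_0_iff)

lemma countable_anchored_sets:
  assumes "countable (verts G)"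
  shows "countable (anchored_sets G r)"
proof (rule countable_subset)
  show "anchored_sets G r \<subseteq> {S. finite S \<and> S \<subseteq> verts G}"
    by (auto simp: anchored_sets_def)
  show "countable {S. finite S \<and> S \<subseteq> verts G}"
    using assms by (rule countable_Collect_finite_subset)
qed

lemma anchored_vertex_expansion_gt_imp:
  assumes "anchored_vertex_expansion G r > ereal h"
  obtains N where "\<And>S. S \<in> anchored_sets G r \<Longrightarrow> N \<le> card S \<Longrightarrow>
      h * real (card S) \<le> real (card (vertex_boundary G S))"
proof -
  from order_tendstoD(1)[OF anchored_vertex_ratio_inf_LIMSEQ assms]
  obtain N where N: "anchored_vertex_ratio_inf G r N > ereal h"
    by (auto simp: eventually_sequentially)
  show ?thesis
  proof
    fix S assume S: "S \<in> anchored_sets G r" "N \<le> card S"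
    have "ereal h < ereal (real (card (vertex_boundary G S)) / real (card S))"
      using S by (intro less_le_trans[OF N[unfolded anchored_vertex_ratio_inf_eq]] INF_lower) auto
    then show "h * real (card S) \<le> real (card (vertex_boundary G S))"
      using anchored_setsD(4)[OF S(1)] by (simp add: field_simps)
  qed
qed

lemma anchored_vertex_expansion_geI:
  assumes "\<And>S. S \<in> anchored_sets G r \<Longrightarrow> N \<le> card S \<Longrightarrow>
      h * real (card S) \<le> real (card (vertex_boundary G S))"
  shows "ereal h \<le> anchored_vertex_expansion G r"
proof (rule LIMSEQ_le_const[OF anchored_vertex_ratio_inf_LIMSEQ], intro exI allI impI)
  fix n assume "N \<le> n"
  show "ereal h \<le> anchored_vertex_ratio_inf G r n"
    unfolding anchored_vertex_ratio_inf_eq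
  proof (rule INF_greatest)
    fix S assume "S \<in> {S \<in> anchored_sets G r. n \<le> card S}"
    with assms[of S] \<open>N \<le> n\<close> anchored_setsD(4)[of S G r]
    show "ereal h \<le> ereal (real (card (vertex_boundary G S)) / real (card S))"
      by (simp add: field_simps)
  qed
qed

lemma open_cluster_eq_induce:
  "open_cluster G \<omega> r = G \<restriction> verts (open_cluster G \<omega> r)"
  and verts_open_cluster_subset:
    "verts (open_cluster G \<omega> r) \<subseteq> {v \<in> verts G. \<omega> v}"
proof -
  show *: "verts (open_cluster G \<omega> r) \<subseteq> {v \<in> verts G. \<omega> v}"
    by (auto simp: open_cluster_def open_subgraph_def elim!: reachable_in_vertsE)
  then show "open_cluster G \<omega> r = G \<restriction> verts (open_cluster G \<omega> r)"
    by (auto simp: open_cluster_def open_subgraph_def induce_subgraph_def)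
qed

lemma anchored_sets_open_cluster:
  assumes "S \<in> anchored_sets (open_cluster G \<omega> r) r"
  shows "S \<in> anchored_sets G r" and "\<forall>v\<in>S. \<omega> v"
proof -
  let ?V = "verts (open_cluster G \<omega> r)"
  have S: "r \<in> S" "S \<subseteq> ?V" "Digraph_Component.connected (open_cluster G \<omega> r \<restriction> S)" "finite S"
    using assms by (auto simp: anchored_sets_def)
  have "open_cluster G \<omega> r \<restriction> S = G \<restriction> S"
    using induce_induce_subset[OF S(2)] open_cluster_eq_induce by metis
  with S verts_open_cluster_subset[of G \<omega> r] show "S \<in> anchored_sets G r"
    by (auto simp: anchored_sets_def)
  show "\<forall>v\<in>S. \<omega> v" using S(2) verts_open_cluster_subset[of G \<omega> r] by blast
qed

text \<open>
  An open boundary vertex in \<open>G\<close> of a subset of the cluster belongs to the cluster itself.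
\<close>

lemma vertex_boundary_open_cluster:
  assumes "sym_digraph G" "S \<subseteq> verts (open_cluster G \<omega> r)"
  shows "vertex_boundary (open_cluster G \<omega> r) S = {v \<in> vertex_boundary G S. \<omega> v}"
proof -
  interpret sym_digraph G by fact
  interpret O: wf_digraph "open_subgraph G \<omega>"
    unfolding open_subgraph_def by auto
  let ?V = "verts (open_cluster G \<omega> r)"
  have adj: "u \<rightarrow>\<^bsub>open_cluster G \<omega> r\<^esub> v \<longleftrightarrow> u \<rightarrow>\<^bsub>G\<^esub> v \<and> u \<in> ?V \<and> v \<in> ?V" for u v
    using dominates_induce_iff[of u v G ?V] open_cluster_eq_induce by metis
  have step: "v \<in> ?V" if "u \<in> ?V" "u \<rightarrow>\<^bsub>G\<^esub> v" "\<omega> v" for u v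
  proof -
    have "u \<rightarrow>\<^bsub>open_subgraph G \<omega>\<^esub> v"
      using that verts_open_cluster_subset[of G \<omega> r] adj_in_verts(2)[OF that(2)]
      by (auto simp: open_subgraph_def dominates_induce_iff)
    moreover have "r \<rightarrow>\<^sup>*\<^bsub>open_subgraph G \<omega>\<^esub> u"
      using that(1) by (simp add: open_cluster_def)
    ultimately show ?thesis
      by (simp add: open_cluster_def O.reachable_adj_trans)
  qed
  show ?thesis
    using assms(2) step verts_open_cluster_subset[of G \<omega> r]
    by (auto simp: vertex_boundary_def adj)
qed

section \<open>Cylinder events\<close>

text \<open>
  The event that all vertices in \<open>A\<close> are open and all vertices in \<open>B\<close> are closed. The
  extensional function space is the sample space of \<^const>\<open>site_percolation\<close>, which does not
  depend on \<open>p\<close>; the same event can thus be measured at different parameters.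
\<close>

definition cylinder :: "('a, 'b) pre_digraph \<Rightarrow> 'a set \<Rightarrow> 'a set \<Rightarrow> ('a \<Rightarrow> bool) set" where
  "cylinder G A B = {\<omega> \<in> verts G \<rightarrow>\<^sub>E UNIV. (\<forall>v\<in>A. \<omega> v) \<and> (\<forall>v\<in>B. \<not> \<omega> v)}"

lemma space_site_percolation: "space (site_percolation G p) = verts G \<rightarrow>\<^sub>E UNIV"
  by (simp add: site_percolation_def space_PiM)

lemma prob_space_site_percolation: "prob_space (site_percolation G p)"
  unfolding site_percolation_def by (intro prob_space_PiM prob_space_measure_pmf)

lemma
  assumes "finite A" "finite B" "A \<subseteq> verts G" "B \<subseteq> verts G" "A \<inter> B = {}"
  shows sets_cylinder: "cylinder G A B \<in> sets (site_percolation G p)"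
    and measure_cylinder: "0 \<le> p \<Longrightarrow> p \<le> 1 \<Longrightarrow>
      measure (site_percolation G p) (cylinder G A B) = p ^ card A * (1 - p) ^ card B"
proof -
  let ?M = "\<lambda>_::'a. measure_pmf (bernoulli_pmf p)"
  interpret product_prob_space ?M "verts G"
    by unfold_locales
  let ?X = "\<lambda>v. {v \<in> A}"
  have *: "cylinder G A B = prod_emb (verts G) ?M (A \<union> B) (Pi\<^sub>E (A \<union> B) ?X)"
    using assms by (auto simp: cylinder_def prod_emb_def space_PiM Pi_iff PiE_iff extensional_def)
  show "cylinder G A B \<in> sets (site_percolation G p)"
    unfolding * site_percolation_def using assms by (intro sets_PiM_I) auto
  assume p: "0 \<le> p" "p \<le> 1"
  have "measure (site_percolation G p) (cylinder G A B) = (\<Prod>v\<in>A \<union> B. measure (?M v) (?X v))"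
    unfolding * site_percolation_def using assms by (intro measure_PiM_emb) auto
  also have "\<dots> = (\<Prod>v\<in>A. measure (?M v) (?X v)) * (\<Prod>v\<in>B. measure (?M v) (?X v))"
    using assms by (intro prod.union_disjoint) auto
  also have "(\<Prod>v\<in>A. measure (?M v) (?X v)) = (\<Prod>v\<in>A. p)"
    using p by (intro prod.cong) (auto simp: measure_pmf_single)
  also have "(\<Prod>v\<in>B. measure (?M v) (?X v)) = (\<Prod>v\<in>B. 1 - p)"
  proof (intro prod.cong refl)
    fix v assume "v \<in> B"
    then have "v \<notin> A" using assms(5) by blast
    then show "measure (?M v) (?X v) = 1 - p" using p by (simp add: measure_pmf_single)
  qed
  finally show "measure (site_percolation G p) (cylinder G A B) = p ^ card A * (1 - p) ^ card B"
    by simp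
qed

text \<open>
  If \<open>S'\<close> is open and the boundary of \<open>S\<close> is closed, then a path inside \<open>S'\<close> from \<open>r\<close> cannot
  leave \<open>S\<close>; hence \<open>S' \<subseteq> S\<close>. By symmetry two such events with a common configuration
  belong to the same set.
\<close>

lemma disjoint_cylinders:
  assumes "sym_digraph G"
  shows "disjoint_family_on (\<lambda>S. cylinder G S (vertex_boundary G S)) (anchored_sets G r)"
proof -
  interpret sym_digraph G by fact
  have sub: "S' \<subseteq> S"
    if S: "S \<in> anchored_sets G r" "S' \<in> anchored_sets G r"
      and \<omega>: "\<forall>v\<in>S'. \<omega> v" "\<forall>v\<in>vertex_boundary G S. \<not> \<omega> v" for S S' \<omega>
  proof
    fix x assume "x \<in> S'"
    have "r \<rightarrow>\<^sup>*\<^bsub>G \<restriction> S'\<^esub> x"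
      using S(2) \<open>x \<in> S'\<close> by (intro connected_induce_reachable[OF assms]) (auto simp: anchored_sets_def)
    then show "x \<in> S"
    proof (induction rule: wf_digraph.reachable_induct[OF wellformed_induce_subgraph, consumes 1])
      case 1
      then show ?case using S(1) by (auto simp: anchored_sets_def)
    next
      case (2 y z)
      then have yz: "y \<rightarrow>\<^bsub>G\<^esub> z" "z \<in> S'" by (auto simp: dominates_induce_iff)
      show ?case
      proof (rule ccontr)
        assume "z \<notin> S"
        then have "z \<in> vertex_boundary G S"
          using yz 2 adj_in_verts(2) by (auto simp: vertex_boundary_def)
        with \<omega> yz show False by blast
      qed
    qed
  qed
  show ?thesis
    unfolding disjoint_family_on_def
  proof (intro ballI impI)
    fix S S' assume S: "S \<in> anchored_sets G r" "S' \<in> anchored_sets G r" and "S \<noteq> S'"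
    show "cylinder G S (vertex_boundary G S) \<inter> cylinder G S' (vertex_boundary G S') = {}"
    proof (rule ccontr)
      assume "\<not> ?thesis"
      then obtain \<omega> where "\<forall>v\<in>S. \<omega> v" "\<forall>v\<in>vertex_boundary G S. \<not> \<omega> v"
          "\<forall>v\<in>S'. \<omega> v" "\<forall>v\<in>vertex_boundary G S'. \<not> \<omega> v"
        by (auto simp: cylinder_def)
      then have "S = S'" using S by (intro subset_antisym sub)
      with \<open>S \<noteq> S'\<close> show False ..
    qed
  qed
qed

text \<open>
  The event that \<open>S\<close> is open and has at most \<open>\<epsilon> |S|\<close> open boundary vertices. For an anchored set
  \<open>S\<close> this says that \<open>S\<close> lies in the open cluster of the root and has boundary ratio at most \<open>\<epsilon>\<close>
  there.
\<close>

definition thin_event :: "('a, 'b) pre_digraph \<Rightarrow> real \<Rightarrow> 'a set \<Rightarrow> ('a \<Rightarrow> bool) set" where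
  "thin_event G \<epsilon> S = {\<omega> \<in> verts G \<rightarrow>\<^sub>E UNIV. (\<forall>v\<in>S. \<omega> v) \<and>
     real (card {v \<in> vertex_boundary G S. \<omega> v}) \<le> \<epsilon> * real (card S)}"

text \<open>
  The Chernoff bound for the number of open boundary vertices, obtained by decomposing the event
  according to the set \<open>T\<close> of these vertices and resumming with the binomial formula.
\<close>

lemma
  assumes "locally_finite G" "finite S" "S \<subseteq> verts G"
  shows sets_thin_event: "thin_event G \<epsilon> S \<in> sets (site_percolation G p)"
    and measure_thin_event_le:
      "0 \<le> p \<Longrightarrow> p \<le> 1 \<Longrightarrow> 0 < t \<Longrightarrow> t < 1 \<Longrightarrow>
       measure (site_percolation G p) (thin_event G \<epsilon> S) \<le>
         p ^ card S * t powr (- \<epsilon> * real (card S)) * (p * t + (1 - p)) ^ card (vertex_boundary G S)"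
proof -
  let ?D = "vertex_boundary G S" and ?P = "site_percolation G p"
  let ?n = "card S"
  interpret prob_space ?P by (rule prob_space_site_percolation)
  have fin: "finite ?D" using assms by (rule finite_vertex_boundary)
  note D = vertex_boundary_subset[of G S] vertex_boundary_disjoint[of S G]
  define J where "J = {T \<in> Pow ?D. real (card T) \<le> \<epsilon> * real ?n}"
  have finJ: "finite J" using fin by (simp add: J_def)
  have J: "T \<subseteq> ?D" "finite T" "S \<inter> T = {}" if "T \<in> J" for T
    using that fin D by (auto simp: J_def intro: finite_subset)
  have eq: "thin_event G \<epsilon> S = (\<Union>T\<in>J. cylinder G (S \<union> T) (?D - T))"
  proof (intro set_eqI iffI)
    fix \<omega> assume "\<omega> \<in> thin_event G \<epsilon> S"
    then show "\<omega> \<in> (\<Union>T\<in>J. cylinder G (S \<union> T) (?D - T))"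
      by (intro UN_I[of "{v \<in> ?D. \<omega> v}"]) (auto simp: thin_event_def cylinder_def J_def)
  next
    fix \<omega> assume "\<omega> \<in> (\<Union>T\<in>J. cylinder G (S \<union> T) (?D - T))"
    then obtain T where T: "T \<in> J" "\<omega> \<in> cylinder G (S \<union> T) (?D - T)" by blast
    then have "{v \<in> ?D. \<omega> v} = T" using J(1)[OF T(1)] by (auto simp: cylinder_def)
    with T show "\<omega> \<in> thin_event G \<epsilon> S" by (auto simp: thin_event_def cylinder_def J_def)
  qed
  have sets: "cylinder G (S \<union> T) (?D - T) \<in> sets ?P" if "T \<in> J" for T
    using J[OF that] assms fin D by (intro sets_cylinder) auto
  show "thin_event G \<epsilon> S \<in> sets ?P"
    unfolding eq using finJ sets by (intro sets.finite_UN) auto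
  assume p: "0 \<le> p" "p \<le> 1" and t: "0 < t" "t < 1"
  let ?c = "t powr (- \<epsilon> * real ?n)"
  have "measure ?P (thin_event G \<epsilon> S) \<le> (\<Sum>T\<in>J. measure ?P (cylinder G (S \<union> T) (?D - T)))"
    unfolding eq using finJ sets by (intro finite_measure_subadditive_finite) auto
  also have "\<dots> = (\<Sum>T\<in>J. p ^ ?n * (p ^ card T * (1 - p) ^ card (?D - T)))"
  proof (intro sum.cong refl)
    fix T assume T: "T \<in> J"
    have "card (S \<union> T) = ?n + card T"
      using J[OF T] assms by (intro card_Un_disjoint) auto
    then show "measure ?P (cylinder G (S \<union> T) (?D - T))
        = p ^ ?n * (p ^ card T * (1 - p) ^ card (?D - T))"
      using J[OF T] assms fin D p
      by (subst measure_cylinder) (auto simp: power_add)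
  qed
  also have "\<dots> \<le> (\<Sum>T\<in>J. p ^ ?n * ?c * ((p * t) ^ card T * (1 - p) ^ card (?D - T)))"
  proof (rule sum_mono)
    fix T assume T: "T \<in> J"
    \<comment> \<open>Since \<open>t < 1\<close>, the weight \<open>t ^ (card T - \<epsilon> n)\<close> is at least 1 when \<open>card T \<le> \<epsilon> n\<close>.\<close>
    have "t powr (\<epsilon> * real ?n) \<le> t powr real (card T)"
      using T t by (intro powr_mono') (auto simp: J_def)
    then have "1 \<le> ?c * t ^ card T"
      using t by (simp add: powr_minus powr_realpow field_simps)
    then have "p ^ ?n * (p ^ card T * (1 - p) ^ card (?D - T)) * 1
        \<le> p ^ ?n * (p ^ card T * (1 - p) ^ card (?D - T)) * (?c * t ^ card T)"
      using p by (intro mult_left_mono) auto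
    then show "p ^ ?n * (p ^ card T * (1 - p) ^ card (?D - T))
        \<le> p ^ ?n * ?c * ((p * t) ^ card T * (1 - p) ^ card (?D - T))"
      by (simp add: power_mult_distrib algebra_simps)
  qed
  also have "\<dots> \<le> (\<Sum>T\<in>Pow ?D. p ^ ?n * ?c * ((p * t) ^ card T * (1 - p) ^ card (?D - T)))"
    using fin p t by (intro sum_mono2) (auto simp: J_def)
  also have "\<dots> = p ^ ?n * ?c * (\<Sum>T\<in>Pow ?D. (\<Prod>_\<in>T. p * t) * (\<Prod>_\<in>?D - T. 1 - p))"
    by (simp add: sum_distrib_left)
  also have "(\<Sum>T\<in>Pow ?D. (\<Prod>_\<in>T. p * t) * (\<Prod>_\<in>?D - T. 1 - p)) = (p * t + (1 - p)) ^ card ?D"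
    using prod_add[OF fin, of "\<lambda>_. p * t" "\<lambda>_. 1 - p"] by simp
  finally show "measure ?P (thin_event G \<epsilon> S) \<le> p ^ ?n * ?c * (p * t + (1 - p)) ^ card ?D" .
qed

section \<open>The exponential estimate\<close>

text \<open>
  Write \<open>s = p - p * t\<close>. The inequality \<open>1 + x \<le> exp x\<close> and \<open>m \<ge> h * n\<close> bound
  \<open>((1 - s) / (1 - q)) ^ m\<close> by \<open>exp (- n * (s - q) / q)\<close>, because \<open>h / (1 - q) = 1 / q\<close>. For
  \<open>t = 0\<close> and \<open>\<epsilon> = 0\<close> the quotient of the two sides is then at most \<open>exp (- n * \<delta>)\<close>, where
  \<open>\<delta> = p / q - 1 - ln (p / q) > 0\<close>. The parameters \<open>t\<close> and \<open>\<epsilon>\<close> are chosen such that each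
  of them costs a factor \<open>exp (n * \<delta> / 2)\<close>.
\<close>

lemma exponential_comparison:
  fixes h p q :: real
  assumes "0 < h" and q_def: "q = 1 / (1 + h)" and "q < p" "p \<le> 1"
  obtains \<epsilon> t :: real where "0 < \<epsilon>" "0 < t" "t < 1"
    "\<And>n m :: nat. h * real n \<le> real m \<Longrightarrow>
       p ^ n * t powr (- \<epsilon> * real n) * (p * t + (1 - p)) ^ m \<le> q ^ n * (1 - q) ^ m"
proof -
  have q: "0 < q" "q < 1" "h / (1 - q) = 1 / q"
    using assms(1) by (auto simp: q_def field_simps)
  have "p > 0" using q(1) assms(3) by linarith
  define \<delta> where "\<delta> = p / q - 1 - ln (p / q)"
  have pq: "p / q > 1" using q(1) assms(3) by simp
  have "ln (p / q) < p / q - 1"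
    using pq ln_less_self ln_le_minus_one[of "p / q"] ln_eq_minus_one[of "p / q"] by linarith
  then have \<delta>: "0 < \<delta>" by (simp add: \<delta>_def)
  have "\<delta> \<le> p / q - 1" using pq by (simp add: \<delta>_def)
  then have \<delta>q: "\<delta> * q \<le> p - q" using q by (simp add: field_simps)
  define t where "t = \<delta> * q / (2 * p)"
  have pt: "p * t = \<delta> * q / 2" using \<open>p > 0\<close> by (simp add: t_def)
  have t: "0 < t" "t < 1"
    using \<delta> \<delta>q q \<open>p > 0\<close> by (auto simp: t_def field_simps)
  define \<epsilon> where "\<epsilon> = \<delta> / (2 * (- ln t))"
  have lnt: "ln t < 0" using t by simp
  have \<epsilon>: "0 < \<epsilon>" using \<delta> lnt unfolding \<epsilon>_def by (intro divide_pos_pos) auto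
  have \<epsilon>t: "- \<epsilon> * ln t = \<delta> / 2" using lnt by (simp add: \<epsilon>_def)
  define s where "s = p - p * t"
  have s: "q \<le> s" "s \<le> 1"
    using pt \<delta>q mult_pos_pos[OF \<delta> q(1)] assms(4) unfolding s_def by linarith+
  show ?thesis
  proof (rule that[OF \<epsilon> t])
    fix n m :: nat assume nm: "h * real n \<le> real m"
    have 1: "p ^ n = q ^ n * exp (real n * ln (p / q))"
      using q \<open>p > 0\<close> by (simp add: exp_of_nat_mult power_divide)
    have 2: "t powr (- \<epsilon> * real n) = exp (real n * (\<delta> / 2))"
      using t \<epsilon>t by (simp add: powr_def) (metis mult.commute mult.left_commute mult_minus_left)
    have "(1 - s) / (1 - q) \<le> exp (- ((s - q) / (1 - q)))"
      using exp_ge_add_one_self[of "- ((s - q) / (1 - q))"] q by (simp add: field_simps)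
    then have "((1 - s) / (1 - q)) ^ m \<le> exp (- ((s - q) / (1 - q))) ^ m"
      using s q by (intro power_mono) auto
    also have "\<dots> = exp (- ((s - q) / (1 - q) * real m))"
      by (simp add: exp_of_nat_mult[symmetric] mult.commute)
    also have "\<dots> \<le> exp (- ((s - q) / (1 - q) * (h * real n)))"
      using mult_left_mono[OF nm, of "(s - q) / (1 - q)"] s q by (simp only: exp_le_cancel_iff neg_le_iff_le) simp
    also have "(s - q) / (1 - q) * (h * real n) = real n * ((s - q) * (h / (1 - q)))"
      by simp
    also have "\<dots> = real n * ((s - q) / q)"
      using q(3) by simp
    finally have 3: "(1 - s) ^ m \<le> (1 - q) ^ m * exp (- (real n * ((s - q) / q)))"
      using q by (simp add: power_divide field_simps)
    have "ln (p / q) + \<delta> / 2 - (s - q) / q = 0"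
      using q by (simp add: s_def pt \<delta>_def field_simps)
    then have "real n * ln (p / q) + real n * (\<delta> / 2) + - (real n * ((s - q) / q)) = 0"
      by (metis diff_conv_add_uminus distrib_left mult_minus_right mult_zero_right)
    then have 4: "exp (real n * ln (p / q)) * exp (real n * (\<delta> / 2)) * exp (- (real n * ((s - q) / q))) = 1"
      by (simp only: exp_add[symmetric] exp_zero)
    have "p ^ n * t powr (- \<epsilon> * real n) * (p * t + (1 - p)) ^ m
        = q ^ n * exp (real n * ln (p / q)) * exp (real n * (\<delta> / 2)) * (1 - s) ^ m"
      unfolding 1 2 by (simp add: s_def algebra_simps)
    also have "\<dots> \<le> q ^ n * exp (real n * ln (p / q)) * exp (real n * (\<delta> / 2)) *
        ((1 - q) ^ m * exp (- (real n * ((s - q) / q))))"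
      using 3 q by (intro mult_left_mono) auto
    also have "\<dots> = q ^ n * (1 - q) ^ m *
        (exp (real n * ln (p / q)) * exp (real n * (\<delta> / 2)) * exp (- (real n * ((s - q) / q))))"
      by (simp only: mult_ac)
    finally show "p ^ n * t powr (- \<epsilon> * real n) * (p * t + (1 - p)) ^ m \<le> q ^ n * (1 - q) ^ m"
      unfolding 4 by simp
  qed
qed

section \<open>Persistence of anchored expansion\<close>

theorem theoremA2:
  fixes G :: "('a, 'b) pre_digraph" and r :: 'a and p :: real
  assumes "sym_digraph G"
    and "infinite (verts G)"
    and "Digraph_Component.connected G"
    and "locally_finite G"
    and "r \<in> verts G"
    and "anchored_vertex_expansion G r > 0"
    and "0 \<le> p" and "p \<le> 1"
    and "ereal p > 1 / (anchored_vertex_expansion G r + 1)"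
  shows "AE \<omega> in site_percolation G p.
           infinite (verts (open_cluster G \<omega> r)) \<longrightarrow>
           anchored_vertex_expansion (open_cluster G \<omega> r) r > 0"
proof -
  \<comment> \<open>The expansion may be infinite, so \<open>h\<close> is chosen strictly below it and above \<open>1 / p - 1\<close>.\<close>
  obtain h where h: "0 < h" "ereal h < anchored_vertex_expansion G r" "1 / (1 + h) < p"
  proof -
    have "p > 0"
    proof (rule ccontr)
      assume "\<not> p > 0"
      then have "p = 0" using assms(7) by simp
      then show False
        using assms(6,9) by (cases "anchored_vertex_expansion G r") (auto simp: one_ereal_def)
    qed
    have "ereal (max 0 (1 / p - 1)) < anchored_vertex_expansion G r"
      using assms(6,9) \<open>p > 0\<close>
      by (cases "anchored_vertex_expansion G r") (auto simp: one_ereal_def field_simps simp del: ereal_max)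
    from ereal_dense2[OF this] obtain h
      where "ereal (max 0 (1 / p - 1)) < ereal h" "ereal h < anchored_vertex_expansion G r"
      by blast
    with \<open>p > 0\<close> show ?thesis by (intro that[of h]) (auto simp: field_simps)
  qed
  define q where "q = 1 / (1 + h)"
  have q: "0 \<le> q" "q \<le> 1" using h(1) by (auto simp: q_def)
  obtain \<epsilon> t :: real where \<epsilon>t: "0 < \<epsilon>" "0 < t" "t < 1"
    "\<And>n m :: nat. h * real n \<le> real m \<Longrightarrow>
       p ^ n * t powr (- \<epsilon> * real n) * (p * t + (1 - p)) ^ m \<le> q ^ n * (1 - q) ^ m"
    using exponential_comparison[OF h(1) q_def _ assms(8)] h(3) by (auto simp: q_def)
  obtain N where N: "\<And>S. S \<in> anchored_sets G r \<Longrightarrow> N \<le> card S \<Longrightarrow>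
      h * real (card S) \<le> real (card (vertex_boundary G S))"
    using anchored_vertex_expansion_gt_imp[OF h(2)] by blast
  define F where "F = {S \<in> anchored_sets G r. N \<le> card S}"
  have "AE \<omega> in site_percolation G p. finite {S \<in> F. \<omega> \<in> thin_event G \<epsilon> S}"
  proof (rule AE_finite_occurrences[where N = "site_percolation G q"
        and C = "\<lambda>S. cylinder G S (vertex_boundary G S)"])
    show "countable F"
      using countable_anchored_sets[OF countable_verts[OF assms(1,3,4,5)]]
      by (rule countable_subset[rotated]) (auto simp: F_def)
    show "disjoint_family_on (\<lambda>S. cylinder G S (vertex_boundary G S)) F"
      using disjoint_cylinders[OF assms(1)]
      by (rule disjoint_family_on_mono[rotated]) (auto simp: F_def)
  next
    fix S assume "S \<in> F"
    then have S: "S \<in> anchored_sets G r" "N \<le> card S" by (auto simp: F_def)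
    note S' = anchored_setsD(2,3)[OF S(1)]
    have D: "finite (vertex_boundary G S)"
      using finite_vertex_boundary assms(4) S' by blast
    show "thin_event G \<epsilon> S \<in> sets (site_percolation G p)"
      using assms(4) S' by (intro sets_thin_event) auto
    show "cylinder G S (vertex_boundary G S) \<in> sets (site_percolation G q)"
      using S' D vertex_boundary_subset vertex_boundary_disjoint by (intro sets_cylinder)
    have "measure (site_percolation G p) (thin_event G \<epsilon> S) \<le>
        p ^ card S * t powr (- \<epsilon> * real (card S)) * (p * t + (1 - p)) ^ card (vertex_boundary G S)"
      using assms(4,7,8) S' \<epsilon>t(2,3) by (intro measure_thin_event_le) auto
    also have "\<dots> \<le> q ^ card S * (1 - q) ^ card (vertex_boundary G S)"
      using N[OF S] by (rule \<epsilon>t(4))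
    also have "\<dots> = measure (site_percolation G q) (cylinder G S (vertex_boundary G S))"
      using S' D vertex_boundary_subset vertex_boundary_disjoint q by (intro measure_cylinder[symmetric])
    finally show "measure (site_percolation G p) (thin_event G \<epsilon> S) \<le>
        measure (site_percolation G q) (cylinder G S (vertex_boundary G S))" .
  qed (rule prob_space_site_percolation)+
  with AE_space show ?thesis
  proof eventually_elim
    case (elim \<omega>)
    let ?H = "open_cluster G \<omega> r"
    \<comment> \<open>Only finitely many sets are thin in \<open>\<omega>\<close>; beyond their largest cardinality no anchored set of
      the cluster has boundary ratio at most \<open>\<epsilon>\<close>.\<close>
    define K where "K = Max (insert N (card ` {S \<in> F. \<omega> \<in> thin_event G \<epsilon> S}))"
    have K: "N \<le> K" "\<And>S. S \<in> F \<Longrightarrow> \<omega> \<in> thin_event G \<epsilon> S \<Longrightarrow> card S \<le> K"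
      using elim(2) by (auto simp: K_def intro!: Max_ge)
    have "ereal \<epsilon> \<le> anchored_vertex_expansion ?H r"
    proof (rule anchored_vertex_expansion_geI[of _ _ "Suc K"])
      fix S assume S: "S \<in> anchored_sets ?H r" "Suc K \<le> card S"
      then have "S \<in> F" using K(1) anchored_sets_open_cluster(1) by (auto simp: F_def)
      then have "\<omega> \<notin> thin_event G \<epsilon> S" using K(2) S(2) by fastforce
      then have "\<epsilon> * real (card S) < real (card {v \<in> vertex_boundary G S. \<omega> v})"
        using elim(1) anchored_sets_open_cluster(2)[OF S(1)]
        by (auto simp: thin_event_def space_site_percolation)
      also have "{v \<in> vertex_boundary G S. \<omega> v} = vertex_boundary ?H S"
        using vertex_boundary_open_cluster[OF assms(1)] anchored_setsD(2)[OF S(1)] by blast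
      finally show "\<epsilon> * real (card S) \<le> real (card (vertex_boundary ?H S))" by simp
    qed
    moreover have "0 < ereal \<epsilon>" using \<epsilon>t(1) by simp
    ultimately have "0 < anchored_vertex_expansion ?H r" by (rule less_le_trans[rotated])
    then show ?case ..
  qed
qed

end
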